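(* Let $\mathcal{D}$ be the Dirichlet space on the open unit disk $\mathbb{D}$, let $g_1,\dots,g_n\in\mathcal{D}$ be of the form $g_j(z)=\sum_{m=1}^{\infty}a_{j,m}z^m$, and let $T$ be the finite rank operator on $\mathcal{D}$ given by $T(f)=\sum_{j=1}^n\langle f,g_j\rangle g_j$ for $f\in\mathcal{D}$. Then the Berezin range $\mathbf{Ber}(T)$ is convex in $\mathbb{C}$.
   Context: $\mathbb{D}=\{z\in\mathbb{C}:|z|<1\}$. The Dirichlet space $\mathcal{D}$ consists of all holomorphic $f$ on $\mathbb{D}$ with $\frac1\pi\int_{\mathbb{D}}|f'(z)|^2\,dA(z)<\infty$ ($dA$ = area Lebesgue measure), with inner product $\langle f,g\rangle=\langle f,g\rangle_{H^2(\mathbb{D})}+\frac1\pi\int_{\mathbb{D}}f'(z)\overline{g'(z)}\,dA(z)$, where $\langle\sum a_nz^n,\sum b_nz^n\rangle_{H^2(\mathbb{D})}=\sum a_n\overline{b_n}$. It is a reproducing kernel Hilbert space on $\mathbb{D}$ with kernel $k_w(z)=\frac{1}{z\overline w}\log\big(\frac{1}{1-z\overline w}\big)$ for $w\in\mathbb{D}\setminus\{0\}$ (value $1$ at $z=0$) and $k_0=1$. With $\hat k_\lambda=k_\lambda/\|k_\lambda\|$, the Berezin range of a bounded operator $T$ on $\mathcal{D}$ is $\mathbf{Ber}(T)=\{\langle T\hat k_\lambda,\hat k_\lambda\rangle:\lambda\in\mathbb{D}\}$. *)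

theory Defs
  imports "HOL-Complex_Analysis.Complex_Analysis"
begin

text \<open>
  A function on the open unit disk is represented by a total function on \<^typ>\<open>complex\<close>;
  all notions below depend only on its values on \<^term>\<open>ball (0::complex) 1\<close>.
\<close>

definition dirichlet_space :: "(complex \<Rightarrow> complex) set" where
  "dirichlet_space =
     {f. f holomorphic_on ball 0 1 \<and>
         set_integrable lborel (ball 0 1) (\<lambda>z. (cmod (deriv f z))\<^sup>2)}"

definition taylor_coeff :: "(complex \<Rightarrow> complex) \<Rightarrow> nat \<Rightarrow> complex" where
  "taylor_coeff f m = (deriv ^^ m) f 0 / fact m"

definition hardy_inner :: "(complex \<Rightarrow> complex) \<Rightarrow> (complex \<Rightarrow> complex) \<Rightarrow> complex" where
  "hardy_inner f g = (\<Sum>m. taylor_coeff f m * cnj (taylor_coeff g m))"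

definition dirichlet_inner :: "(complex \<Rightarrow> complex) \<Rightarrow> (complex \<Rightarrow> complex) \<Rightarrow> complex" where
  "dirichlet_inner f g =
     hardy_inner f g +
     1 / of_real pi * (LINT z:ball 0 1|lborel. deriv f z * cnj (deriv g z))"

definition dirichlet_norm :: "(complex \<Rightarrow> complex) \<Rightarrow> real" where
  "dirichlet_norm f = sqrt (Re (dirichlet_inner f f))"

text \<open>
  The reproducing kernel at \<open>w\<close>, as a function of \<open>z\<close>. For \<open>z\<close>, \<open>w\<close> in the unit disk
  \<open>1 - z * cnj w\<close> has positive real part, so \<^const>\<open>Ln\<close> is the principal branch away from its cut.
\<close>

definition dirichlet_kernel :: "complex \<Rightarrow> complex \<Rightarrow> complex" where
  "dirichlet_kernel w z =
     (if w = 0 \<or> z = 0 then 1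
      else 1 / (z * cnj w) * Ln (1 / (1 - z * cnj w)))"

definition normalized_kernel :: "complex \<Rightarrow> complex \<Rightarrow> complex" where
  "normalized_kernel w =
     (\<lambda>z. dirichlet_kernel w z / of_real (dirichlet_norm (dirichlet_kernel w)))"

definition berezin_range :: "((complex \<Rightarrow> complex) \<Rightarrow> (complex \<Rightarrow> complex)) \<Rightarrow> complex set" where
  "berezin_range T =
     {dirichlet_inner (T (normalized_kernel w)) (normalized_kernel w) | w. w \<in> ball 0 1}"

end

theory Submission
  imports Defs
begin

text \<open>
  With \<open>k\<^sub>w\<close> the kernel at \<open>w\<close>, the Berezin transform of \<open>T\<close> at \<open>w\<close> equals
  \<open>(\<Sum>j. \<bar>\<langle>k\<^sub>w, g\<^sub>j\<rangle>\<bar>\<^sup>2) / \<parallel>k\<^sub>w\<parallel>\<^sup>2\<close>. It is real and continuous in \<open>w\<close>, so the Berezin range is a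
  connected subset of the real line, hence convex. The reproducing property is not needed:
  as \<open>k\<^sub>w(z) = F(z * cnj w)\<close> with \<open>F\<close> holomorphic on the disk, the Hardy part of \<open>\<langle>k\<^sub>w, g\<^sub>j\<rangle>\<close> is a
  power series in \<open>cnj w\<close>, and the area integral is continuous by dominated convergence.
\<close>

section \<open>Dependence on the values in the disk only\<close>

lemma higher_deriv_cong_ball:
  assumes "\<And>z. z \<in> ball 0 1 \<Longrightarrow> f z = f' z" "z \<in> ball 0 (1::real)"
  shows "(deriv ^^ m) f z = (deriv ^^ m) f' z"
proof (rule higher_deriv_cong_ev)
  show "\<forall>\<^sub>F x in nhds z. f x = f' x"
    using eventually_nhds_in_open[OF open_ball assms(2)] by eventually_elim (use assms in blast)
qed simp

lemma dirichlet_space_cong: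
  assumes "\<And>z. z \<in> ball 0 1 \<Longrightarrow> f z = f' z"
  shows "f \<in> dirichlet_space \<longleftrightarrow> f' \<in> dirichlet_space"
proof -
  have "deriv f z = deriv f' z" if "z \<in> ball 0 1" for z
    using higher_deriv_cong_ball[of f f' z 1] assms that by simp
  then have "set_integrable lborel (ball 0 1) (\<lambda>z. (cmod (deriv f z))\<^sup>2) \<longleftrightarrow>
      set_integrable lborel (ball 0 1) (\<lambda>z. (cmod (deriv f' z))\<^sup>2)"
    by (intro set_integrable_cong) auto
  moreover have "f holomorphic_on ball 0 1 \<longleftrightarrow> f' holomorphic_on ball 0 1"
    using assms by (intro holomorphic_cong) auto
  ultimately show ?thesis
    by (simp add: dirichlet_space_def)
qed

text \<open>The kernel at \<open>w\<close> is shown to equal a function of the product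
  \<open>z * cnj w\<close> only for \<open>z\<close> in the disk; this lemma permits replacing one
  by the other inside inner products.\<close>

lemma dirichlet_inner_cong:
  assumes "\<And>z. z \<in> ball 0 1 \<Longrightarrow> f z = f' z" "\<And>z. z \<in> ball 0 1 \<Longrightarrow> g z = g' z"
  shows "dirichlet_inner f g = dirichlet_inner f' g'"
proof -
  have "taylor_coeff f m = taylor_coeff f' m" "taylor_coeff g m = taylor_coeff g' m" for m
    unfolding taylor_coeff_def
    using higher_deriv_cong_ball[of f f' 0] higher_deriv_cong_ball[of g g' 0] assms by auto
  moreover have "deriv f z = deriv f' z" "deriv g z = deriv g' z" if "z \<in> ball 0 1" for z
    using higher_deriv_cong_ball[of f f' z 1] higher_deriv_cong_ball[of g g' z 1] assms that by auto
  ultimately show ?thesis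
    unfolding dirichlet_inner_def hardy_inner_def
    by (simp add: set_lebesgue_integral_cong)
qed

section \<open>Linearity and conjugate symmetry of the inner product\<close>

lemma taylor_coeff_sum:
  assumes "finite J" "\<And>j. j \<in> J \<Longrightarrow> g j holomorphic_on ball 0 1"
  shows "taylor_coeff (\<lambda>z. \<Sum>j\<in>J. c j * g j z) m = (\<Sum>j\<in>J. c j * taylor_coeff (g j) m)"
proof -
  have "(deriv ^^ m) (\<lambda>z. \<Sum>j\<in>J. c j * g j z) 0 = (\<Sum>j\<in>J. c j * (deriv ^^ m) (g j) 0)"
    using assms
  proof (induction J)
    case empty
    show ?case by (induction m) auto
  next
    case (insert j J)
    have "(deriv ^^ m) (\<lambda>z. c j * g j z + (\<Sum>j\<in>J. c j * g j z)) 0 =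
        (deriv ^^ m) (\<lambda>z. c j * g j z) 0 + (deriv ^^ m) (\<lambda>z. \<Sum>j\<in>J. c j * g j z) 0"
      by (rule higher_deriv_add[where S = "ball 0 1"])
        (use insert.prems in \<open>auto intro!: holomorphic_intros\<close>)
    moreover have "(deriv ^^ m) (\<lambda>z. c j * g j z) 0 = c j * (deriv ^^ m) (g j) 0"
      by (rule higher_deriv_cmult[where A = "ball 0 1"]) (use insert.prems in auto)
    ultimately show ?case
      using insert by simp
  qed
  then show ?thesis
    by (simp add: taylor_coeff_def sum_divide_distrib)
qed

text \<open>Both parts are linear term by term. Convergence has to be supplied for each
  \<open>j\<close>, because \<open>suminf\<close> and the Bochner integral are total and additive
  only on convergent data.\<close>

lemma dirichlet_inner_sum_left:
  assumes "finite J" and hol: "\<And>j. j \<in> J \<Longrightarrow> g j holomorphic_on ball 0 1"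
    and summ: "\<And>j. j \<in> J \<Longrightarrow> summable (\<lambda>m. taylor_coeff (g j) m * cnj (taylor_coeff f m))"
    and int: "\<And>j. j \<in> J \<Longrightarrow> set_integrable lborel (ball 0 1) (\<lambda>z. deriv (g j) z * cnj (deriv f z))"
  shows "dirichlet_inner (\<lambda>z. \<Sum>j\<in>J. c j * g j z) f = (\<Sum>j\<in>J. c j * dirichlet_inner (g j) f)"
proof -
  have "hardy_inner (\<lambda>z. \<Sum>j\<in>J. c j * g j z) f =
      (\<Sum>m. \<Sum>j\<in>J. c j * (taylor_coeff (g j) m * cnj (taylor_coeff f m)))"
    using assms(1) hol by (simp add: hardy_inner_def taylor_coeff_sum sum_distrib_right mult.assoc)
  also have "\<dots> = (\<Sum>j\<in>J. c j * hardy_inner (g j) f)"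
    by (subst suminf_sum) (auto simp: hardy_inner_def suminf_mult summ intro: summable_mult)
  finally have H: "hardy_inner (\<lambda>z. \<Sum>j\<in>J. c j * g j z) f = (\<Sum>j\<in>J. c j * hardy_inner (g j) f)" .
  have D: "deriv (\<lambda>z. \<Sum>j\<in>J. c j * g j z) z = (\<Sum>j\<in>J. c j * deriv (g j) z)" if "z \<in> ball 0 1" for z
    by (rule DERIV_imp_deriv)
      (use hol that in \<open>auto intro!: derivative_eq_intros holomorphic_derivI[where S = "ball 0 1"]
        simp: mult.commute\<close>)
  have "(LINT z:ball 0 1|lborel. deriv (\<lambda>z. \<Sum>j\<in>J. c j * g j z) z * cnj (deriv f z)) =
      (LINT z:ball 0 1|lborel. \<Sum>j\<in>J. c j * (deriv (g j) z * cnj (deriv f z)))"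
    by (rule set_lebesgue_integral_cong) (auto simp: D sum_distrib_right mult.assoc)
  also have "\<dots> = (\<Sum>j\<in>J. LINT z:ball 0 1|lborel. c j * (deriv (g j) z * cnj (deriv f z)))"
    unfolding set_lebesgue_integral_def scaleR_sum_right
    by (rule Bochner_Integration.integral_sum)
      (use int in \<open>auto simp: set_integrable_def[symmetric]\<close>)
  finally show ?thesis
    by (simp add: dirichlet_inner_def H sum.distrib algebra_simps sum_distrib_left)
qed

lemma dirichlet_inner_commute:
  assumes "summable (\<lambda>m. taylor_coeff f m * cnj (taylor_coeff g m))"
  shows "dirichlet_inner g f = cnj (dirichlet_inner f g)"
proof -
  have "(\<lambda>m. cnj (taylor_coeff f m * cnj (taylor_coeff g m))) sums cnj (hardy_inner f g)"
    unfolding sums_cnj hardy_inner_def using assms by (rule summable_sums)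
  then have "hardy_inner g f = cnj (hardy_inner f g)"
    by (simp add: hardy_inner_def[of g f] sums_iff mult.commute)
  \<comment> \<open>Conjugation commutes with the Bochner integral unconditionally: in the
    non-integrable case both sides are 0.\<close>
  moreover have "(LINT z:ball 0 1|lborel. deriv g z * cnj (deriv f z)) =
      cnj (LINT z:ball 0 1|lborel. deriv f z * cnj (deriv g z))"
    unfolding set_lebesgue_integral_def Bochner_Integration.integral_cnj[symmetric]
    by (intro Bochner_Integration.integral_cong) (auto simp: mult.commute)
  ultimately show ?thesis
    by (simp add: dirichlet_inner_def)
qed

section \<open>Continuity of parameter integrals and of Hadamard products\<close>

lemma continuous_on_set_lebesgue_integral:
  fixes \<Phi> :: "complex \<Rightarrow> complex \<Rightarrow> complex" and G :: "complex \<Rightarrow> real"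
  assumes "A \<in> sets borel" and G: "set_integrable lborel A G"
    and meas: "\<And>w. w \<in> S \<Longrightarrow> continuous_on A (\<Phi> w)"
    and bound: "\<And>w z. w \<in> S \<Longrightarrow> z \<in> A \<Longrightarrow> cmod (\<Phi> w z) \<le> G z"
    and cont: "\<And>z. z \<in> A \<Longrightarrow> continuous_on S (\<lambda>w. \<Phi> w z)"
  shows "continuous_on S (\<lambda>w. LINT z:A|lborel. \<Phi> w z)"
proof -
  have M: "(\<lambda>z. indicat_real A z *\<^sub>R \<Phi> w z) \<in> borel_measurable lborel" if "w \<in> S" for w
    using borel_measurable_continuous_on_indicator[OF assms(1) meas[OF that]] by simp
  show ?thesis
    \<comment> \<open>Continuity is tested along sequences, the form in which dominated convergence
      applies; \<open>G\<close> is the common majorant.\<close>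
    unfolding continuous_on_sequentially set_lebesgue_integral_def comp_def
  proof safe
    fix x w assume w: "w \<in> S" and x: "\<forall>n. x n \<in> S" "x \<longlonglongrightarrow> w"
    show "(\<lambda>n. LINT z|lborel. indicat_real A z *\<^sub>R \<Phi> (x n) z) \<longlonglongrightarrow> (LINT z|lborel. indicat_real A z *\<^sub>R \<Phi> w z)"
    proof (rule integral_dominated_convergence)
      show "integrable lborel (\<lambda>z. indicat_real A z *\<^sub>R G z)"
        using G by (simp add: set_integrable_def)
      show "AE z in lborel. (\<lambda>n. indicat_real A z *\<^sub>R \<Phi> (x n) z) \<longlonglongrightarrow> indicat_real A z *\<^sub>R \<Phi> w z"
      proof (rule AE_I2)
        fix z
        show "(\<lambda>n. indicat_real A z *\<^sub>R \<Phi> (x n) z) \<longlonglongrightarrow> indicat_real A z *\<^sub>R \<Phi> w z"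
          using cont[of z] w x
          by (cases "z \<in> A") (auto simp: continuous_on_sequentially comp_def)
      qed
    qed (use M w x bound in \<open>auto simp: indicator_def\<close>)
  qed
qed

text \<open>Continuity is local, and the majorants below are uniform in \<open>w\<close> only on
  closed disks of radius \<open>r < 1\<close>.\<close>

lemma continuous_on_ball_if_smaller:
  fixes f :: "complex \<Rightarrow> 'a::topological_space"
  assumes "\<And>r. 0 < r \<Longrightarrow> r < 1 \<Longrightarrow> continuous_on (cball 0 r) f"
  shows "continuous_on (ball 0 1) f"
proof (rule continuous_at_imp_continuous_on, safe)
  fix w :: complex assume w: "w \<in> ball 0 1"
  then obtain r where r: "cmod w < r" "r < 1"
    using dense by auto
  moreover have "0 < r"
    using r(1) norm_ge_zero[of w] by linarith
  ultimately have "continuous_on (ball 0 r) f"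
    using assms[of r] ball_subset_cball continuous_on_subset by blast
  with r show "isCont f w"
    by (simp add: continuous_on_eq_continuous_at)
qed

lemma sums_taylor_coeff:
  assumes "f holomorphic_on ball 0 1" "z \<in> ball 0 1"
  shows "(\<lambda>m. taylor_coeff f m * z ^ m) sums f z"
  using holomorphic_power_series[OF assms] by (simp add: taylor_coeff_def)

text \<open>With \<open>s\<close> the square root of \<open>cmod u\<close>, the factor
  \<open>cmod u ^ m\<close> splits into \<open>s ^ m * s ^ m\<close>, one for each coefficient
  sequence. As \<open>s < 1\<close>, one factor is absolutely summable and the other
  bounded.\<close>

lemma summable_hadamard_product:
  assumes f: "f holomorphic_on ball 0 1" and g: "g holomorphic_on ball 0 1" and u: "cmod u < 1"
  shows "summable (\<lambda>m. taylor_coeff f m * cnj (taylor_coeff g m) * u ^ m)"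
proof -
  define s where "s = sqrt (cmod u)"
  obtain t where t: "s < t" "t < 1"
    using dense[of s 1] u by (auto simp: s_def)
  have s: "0 \<le> s" "s\<^sup>2 = cmod u" by (auto simp: s_def)
  have *: "summable (\<lambda>m. cmod (taylor_coeff h m * of_real s ^ m))"
    if "h holomorphic_on ball 0 1" for h
    \<comment> \<open>Convergence at the larger radius \<open>t\<close> gives absolute convergence
      at \<open>s\<close>.\<close>
    by (rule powser_insidea[of _ "of_real t"])
      (use sums_taylor_coeff[OF that, of "of_real t"] t s in \<open>auto simp: sums_iff\<close>)
  have "bounded (range (\<lambda>m. cmod (taylor_coeff g m * of_real s ^ m)))"
    using summable_imp_bounded[OF *[OF g]] .
  then obtain B where B: "\<And>m. cmod (taylor_coeff g m * of_real s ^ m) \<le> B"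
    unfolding bounded_iff by auto
  show ?thesis
  proof (rule summable_comparison_test')
    show "summable (\<lambda>m. cmod (taylor_coeff f m * of_real s ^ m) * B)"
      by (intro summable_mult2 * f)
    fix m :: nat
    have "cmod (taylor_coeff f m * cnj (taylor_coeff g m) * u ^ m) =
        cmod (taylor_coeff f m * of_real s ^ m) * cmod (taylor_coeff g m * of_real s ^ m)"
      using s by (simp add: norm_mult norm_power power2_eq_square flip: s(2) power_mult_distrib)
    also have "\<dots> \<le> cmod (taylor_coeff f m * of_real s ^ m) * B"
      by (intro mult_left_mono B) auto
    finally show "cmod (taylor_coeff f m * cnj (taylor_coeff g m) * u ^ m) \<le> \<dots>" .
  qed
qed

lemma continuous_on_hadamard_product:
  assumes f: "f holomorphic_on ball 0 1" and g: "g holomorphic_on ball 0 1"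
  shows "continuous_on (ball 0 1) (\<lambda>u. \<Sum>m. taylor_coeff f m * cnj (taylor_coeff g m) * u ^ m)"
proof (rule continuous_at_imp_continuous_on, safe)
  fix u :: complex assume "u \<in> ball 0 1"
  then obtain t where t: "cmod u < t" "t < 1"
    using dense by auto
  \<comment> \<open>A power series is continuous at \<open>u\<close> once it converges at a point of
    larger modulus, here \<open>t\<close>.\<close>
  then have "cmod (of_real t) < 1"
    using norm_ge_zero[of u] by (simp del: norm_ge_zero)
  from isCont_powser[OF summable_hadamard_product[OF f g this], of u] t
  show "isCont (\<lambda>u. \<Sum>m. taylor_coeff f m * cnj (taylor_coeff g m) * u ^ m) u"
    by simp
qed

section \<open>Dilates \<open>F (z * cnj w)\<close> of a holomorphic function\<close>

lemma dilate_in_ball: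
  fixes z w :: complex
  assumes "z \<in> ball 0 1" "w \<in> cball 0 r" "r \<le> 1"
  shows "z * cnj w \<in> cball 0 r" "z * cnj w \<in> ball 0 1"
proof -
  have *: "cmod z < 1" "cmod w \<le> r"
    using assms by auto
  have "cmod z * cmod w \<le> 1 * cmod w"
    using * by (intro mult_right_mono) auto
  then show "z * cnj w \<in> cball 0 r"
    using * by (simp add: norm_mult)
  show "z * cnj w \<in> ball 0 1"
  \<comment> \<open>For \<open>r = 1\<close> strictness has to come from \<open>cmod z < 1\<close>,
    which survives multiplication by \<open>cmod w\<close> only if \<open>w\<close> is
    nonzero.\<close>
  proof (cases "w = 0")
    case False
    then have "cmod z * cmod w < 1 * cmod w"
      using * by (intro mult_strict_right_mono) auto
    then show ?thesis
      using * assms(3) by (simp add: norm_mult)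
  qed simp
qed

lemma set_integrable_ball_const: "set_integrable lborel (ball (0::complex) 1) (\<lambda>_. c::real)"
  unfolding set_integrable_def
  using emeasure_bounded_finite[OF bounded_ball, of "0::complex" 1]
  by (intro integrable_scaleR_left integrable_real_indicator) auto

context
  fixes F :: "complex \<Rightarrow> complex"
  assumes F: "F holomorphic_on ball 0 1"
begin

lemma holomorphic_dilate:
  assumes "w \<in> ball 0 1"
  shows "(\<lambda>z. F (z * cnj w)) holomorphic_on ball 0 1"
proof -
  have "F \<circ> (\<lambda>z. z * cnj w) holomorphic_on ball 0 1"
    using dilate_in_ball(2)[of _ w 1] assms
    by (intro holomorphic_on_compose_gen[OF _ F] holomorphic_intros) auto
  then show ?thesis
    by (simp add: comp_def)
qed

lemma deriv_dilate:
  assumes "w \<in> ball 0 1" "z \<in> ball 0 1"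
  shows "deriv (\<lambda>z. F (z * cnj w)) z = deriv F (z * cnj w) * cnj w"
proof (rule DERIV_imp_deriv)
  have "(F has_field_derivative deriv F (z * cnj w)) (at (z * cnj w))"
    using F dilate_in_ball(2)[of z w 1] assms by (intro holomorphic_derivI) auto
  then show "((\<lambda>z. F (z * cnj w)) has_field_derivative deriv F (z * cnj w) * cnj w) (at z)"
    by (rule DERIV_chain2) (auto intro!: derivative_eq_intros)
qed

lemma taylor_coeff_dilate:
  assumes "w \<in> ball 0 1"
  shows "taylor_coeff (\<lambda>z. F (z * cnj w)) m = taylor_coeff F m * cnj w ^ m"
proof -
  have "(deriv ^^ m) (\<lambda>z. F (cnj w * z)) 0 = cnj w ^ m * (deriv ^^ m) F (cnj w * 0)"
    using F dilate_in_ball(2)[of _ w 1] assms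
    by (intro higher_deriv_compose_linear[where S = "ball 0 1" and T = "ball 0 1"])
      (auto simp: mult.commute)
  then show ?thesis
    by (simp add: taylor_coeff_def mult.commute)
qed

text \<open>For \<open>cmod w\<close> at most \<open>r\<close>, the product \<open>z * cnj w\<close>
  stays in the compact disk of radius \<open>r\<close>, where \<open>deriv F\<close> is bounded. The
  bound is uniform in both variables and feeds all the majorants below.\<close>

lemma bounded_deriv_dilate:
  assumes "r < 1"
  obtains M where "\<And>w z. w \<in> cball 0 r \<Longrightarrow> z \<in> ball 0 1 \<Longrightarrow> cmod (deriv F (z * cnj w) * cnj w) \<le> M"
proof -
  have "continuous_on (cball 0 r) (deriv F)"
    using holomorphic_on_subset[OF holomorphic_deriv[OF F open_ball], of "cball 0 r"] assms
    by (intro holomorphic_on_imp_continuous_on) (auto simp: cball_subset_ball_iff)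
  then have "bounded (deriv F ` cball 0 r)"
    by (intro compact_imp_bounded compact_continuous_image) auto
  then obtain M where M: "\<And>u. u \<in> cball 0 r \<Longrightarrow> cmod (deriv F u) \<le> M"
    unfolding bounded_iff by blast
  have "cmod (deriv F (z * cnj w) * cnj w) \<le> M" if "w \<in> cball 0 r" "z \<in> ball 0 1" for w z
  proof -
    have "cmod (deriv F (z * cnj w)) \<le> M"
      using M dilate_in_ball(1)[OF that(2,1)] assms by simp
    moreover have "cmod w \<le> 1"
      using that assms by auto
    moreover from calculation(1) have "0 \<le> M"
      using norm_ge_zero order_trans by blast
    ultimately have "cmod (deriv F (z * cnj w)) * cmod w \<le> M * 1"
      by (intro mult_mono) auto
    then show ?thesis
      by (simp add: norm_mult)
  qed
  then show ?thesis
    using that by blast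
qed

text \<open>Continuity in \<open>z\<close> gives measurability of the integrands; continuity in
  \<open>w\<close> gives their pointwise convergence under the integral.\<close>

lemma continuous_on_deriv_dilate:
  shows "w \<in> ball 0 1 \<Longrightarrow> continuous_on (ball 0 1) (\<lambda>z. deriv F (z * cnj w) * cnj w)"
    and "z \<in> ball 0 1 \<Longrightarrow> r < 1 \<Longrightarrow> continuous_on (cball 0 r) (\<lambda>w. deriv F (z * cnj w) * cnj w)"
proof -
  have D: "continuous_on (ball 0 1) (deriv F)"
    using F by (intro holomorphic_on_imp_continuous_on holomorphic_deriv) auto
  show "continuous_on (ball 0 1) (\<lambda>z. deriv F (z * cnj w) * cnj w)" if "w \<in> ball 0 1"
    by (intro continuous_intros continuous_on_compose2[OF D])
      (use that dilate_in_ball(2)[of _ w 1] in auto)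
  show "continuous_on (cball 0 r) (\<lambda>w. deriv F (z * cnj w) * cnj w)" if "z \<in> ball 0 1" "r < 1"
    by (intro continuous_intros continuous_on_compose2[OF D])
      (use that dilate_in_ball(2)[of z _ r] in auto)
qed

text \<open>For fixed \<open>w\<close> the derivative of the dilate is bounded, and the disk has
  finite area.\<close>

lemma dilate_in_dirichlet_space:
  assumes "w \<in> ball 0 1"
  shows "(\<lambda>z. F (z * cnj w)) \<in> dirichlet_space"
proof -
  obtain M where M: "\<And>z. z \<in> ball 0 1 \<Longrightarrow> cmod (deriv F (z * cnj w) * cnj w) \<le> M"
    using bounded_deriv_dilate[of "cmod w"] assms by (metis mem_ball_0 mem_cball_0 order_refl)
  have "set_integrable lborel (ball 0 1) (\<lambda>z. (cmod (deriv F (z * cnj w) * cnj w))\<^sup>2)"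
  proof (rule set_integrable_bound[OF set_integrable_ball_const[of "M\<^sup>2"]])
    show "set_borel_measurable lborel (ball 0 1) (\<lambda>z. (cmod (deriv F (z * cnj w) * cnj w))\<^sup>2)"
      unfolding set_borel_measurable_def measurable_lborel2
      by (intro borel_measurable_continuous_on_indicator continuous_on_power continuous_on_norm
          continuous_on_deriv_dilate(1)[OF assms]) simp
    show "AE z in lborel. z \<in> ball 0 1 \<longrightarrow>
        norm ((cmod (deriv F (z * cnj w) * cnj w))\<^sup>2) \<le> norm (M\<^sup>2)"
      using M by (auto intro!: AE_I2 power_mono)
  qed
  then have "set_integrable lborel (ball 0 1) (\<lambda>z. (cmod (deriv (\<lambda>z. F (z * cnj w)) z))\<^sup>2)"
    by (rule set_integrable_cong[THEN iffD1, rotated -1]) (auto simp: deriv_dilate[OF assms])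
  then show ?thesis
    using holomorphic_dilate[OF assms] by (simp add: dirichlet_space_def)
qed

text \<open>The Hardy pairing of the dilate with \<open>g\<close> is the Hadamard product of
  \<open>F\<close> and \<open>g\<close> evaluated at \<open>cnj w\<close>, a point of the open
  disk.\<close>

lemma summable_dirichlet_inner_dilate:
  assumes "g \<in> dirichlet_space" "w \<in> ball 0 1"
  shows "summable (\<lambda>m. taylor_coeff (\<lambda>z. F (z * cnj w)) m * cnj (taylor_coeff g m))"
  using summable_hadamard_product[OF F, of g "cnj w"] assms
  by (simp add: taylor_coeff_dilate dirichlet_space_def mult_ac)

end

section \<open>Integrability of pairings and continuity in the kernel point\<close>

lemma dirichlet_space_integrable:
  assumes "f \<in> dirichlet_space" "g \<in> dirichlet_space"
  shows "set_integrable lborel (ball 0 1) (\<lambda>z. deriv f z * cnj (deriv g z))"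
proof (rule set_integrable_bound)
  show "set_integrable lborel (ball 0 1) (\<lambda>z. (cmod (deriv f z))\<^sup>2 + (cmod (deriv g z))\<^sup>2)"
    using assms by (intro set_integral_add) (auto simp: dirichlet_space_def)
  have "continuous_on (ball 0 1) (deriv h)" if "h \<in> dirichlet_space" for h
    using that unfolding dirichlet_space_def
    by (intro holomorphic_on_imp_continuous_on holomorphic_deriv) auto
  then show "set_borel_measurable lborel (ball 0 1) (\<lambda>z. deriv f z * cnj (deriv g z))"
    unfolding set_borel_measurable_def measurable_lborel2
    using assms
    by (intro borel_measurable_continuous_on_indicator continuous_on_mult continuous_on_cnj) auto
  \<comment> \<open>This elementary inequality stands in for Cauchy-Schwarz: two square integrable
    derivatives have an integrable product.\<close>
  have "a * b \<le> a\<^sup>2 + b\<^sup>2" if "a \<ge> 0" "b \<ge> 0" for a b :: real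
    using sum_squares_bound[of a b] mult_nonneg_nonneg[OF that] by linarith
  then show "AE z in lborel. z \<in> ball 0 1 \<longrightarrow> norm (deriv f z * cnj (deriv g z)) \<le>
      norm ((cmod (deriv f z))\<^sup>2 + (cmod (deriv g z))\<^sup>2)"
    by (auto intro!: AE_I2 simp: norm_mult)
qed

lemma continuous_on_dirichlet_inner_dilate:
  assumes F: "F holomorphic_on ball 0 1" and g: "g \<in> dirichlet_space"
  shows "continuous_on (ball 0 1) (\<lambda>w. dirichlet_inner (\<lambda>z. F (z * cnj w)) g)"
proof -
  have g_hol: "g holomorphic_on ball 0 1"
    using g by (simp add: dirichlet_space_def)
  have "continuous_on (ball 0 1)
      (\<lambda>w. \<Sum>m. taylor_coeff F m * cnj (taylor_coeff g m) * cnj w ^ m)"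
    by (intro continuous_on_compose2[OF continuous_on_hadamard_product[OF F g_hol]] continuous_intros) auto
  then have H: "continuous_on (ball 0 1) (\<lambda>w. hardy_inner (\<lambda>z. F (z * cnj w)) g)"
    by (rule continuous_on_eq) (simp add: hardy_inner_def taylor_coeff_dilate[OF F] mult_ac)
  have "continuous_on (ball 0 1)
      (\<lambda>w. LINT z:ball 0 1|lborel. deriv F (z * cnj w) * cnj w * cnj (deriv g z))"
  proof (rule continuous_on_ball_if_smaller)
    fix r :: real assume r: "0 < r" "r < 1"
    obtain M where M: "\<And>w z. w \<in> cball 0 r \<Longrightarrow> z \<in> ball 0 1 \<Longrightarrow>
        cmod (deriv F (z * cnj w) * cnj w) \<le> M"
      using bounded_deriv_dilate[OF F r(2)] by blast
    show "continuous_on (cball 0 r)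
        (\<lambda>w. LINT z:ball 0 1|lborel. deriv F (z * cnj w) * cnj w * cnj (deriv g z))"
    proof (rule continuous_on_set_lebesgue_integral)
      \<comment> \<open>Only the square of \<open>deriv g\<close> is known to be integrable, so the
        majorant uses x \<le> 1 + x^2 and the finite area of the disk.\<close>
      show "set_integrable lborel (ball 0 1) (\<lambda>z. M * (1 + (cmod (deriv g z))\<^sup>2))"
        using g set_integrable_ball_const[of 1]
        by (intro set_integrable_mult_right set_integral_add(1)) (auto simp: dirichlet_space_def)
      fix w z :: complex assume w: "w \<in> cball 0 r" and z: "z \<in> ball 0 1"
      have "cmod (deriv g z) \<le> 1 + (cmod (deriv g z))\<^sup>2"
        using sum_squares_bound[of 1 "cmod (deriv g z)"] norm_ge_zero[of "deriv g z"]
        by (simp del: norm_ge_zero)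
      then show "cmod (deriv F (z * cnj w) * cnj w * cnj (deriv g z)) \<le> M * (1 + (cmod (deriv g z))\<^sup>2)"
        unfolding norm_mult[of _ "cnj (deriv g z)"]
        using M[OF w z] order_trans[OF norm_ge_zero M[OF w z]] by (intro mult_mono) auto
    next
      fix w :: complex assume "w \<in> cball 0 r"
      then show "continuous_on (ball 0 1) (\<lambda>z. deriv F (z * cnj w) * cnj w * cnj (deriv g z))"
        using continuous_on_deriv_dilate(1)[OF F, of w] r g_hol
        by (intro continuous_on_mult[of _ _ "\<lambda>z. cnj (deriv g z)"] continuous_on_cnj
            holomorphic_on_imp_continuous_on[of "deriv g"] holomorphic_deriv) auto
    next
      fix z :: complex assume "z \<in> ball 0 1"
      then show "continuous_on (cball 0 r) (\<lambda>w. deriv F (z * cnj w) * cnj w * cnj (deriv g z))"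
        using continuous_on_deriv_dilate(2)[OF F, of z r] r
        by (intro continuous_on_mult[where g = "\<lambda>_. cnj (deriv g z)"] continuous_on_const) auto
    qed simp
  qed
  then have "continuous_on (ball 0 1)
      (\<lambda>w. LINT z:ball 0 1|lborel. deriv (\<lambda>z. F (z * cnj w)) z * cnj (deriv g z))"
    by (rule continuous_on_eq)
      (intro set_lebesgue_integral_cong, auto simp: deriv_dilate[OF F])
  then show ?thesis
    unfolding dirichlet_inner_def using H by (intro continuous_intros)
qed

text \<open>Here \<open>w\<close> moves in both slots of the inner product, so continuity in the
  first slot does not suffice. The Hardy part is the Hadamard product of \<open>F\<close> with
  itself at \<open>w * cnj w\<close>, and the area integrand is locally bounded by
  \<open>M * M\<close>.\<close>

lemma continuous_on_dirichlet_norm_dilate: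
  assumes F: "F holomorphic_on ball 0 1"
  shows "continuous_on (ball 0 1) (\<lambda>w. dirichlet_norm (\<lambda>z. F (z * cnj w)))"
proof -
  have sq: "w * cnj w \<in> ball 0 1" if "w \<in> ball 0 1" for w
    using dilate_in_ball(2)[of w w 1] that by auto
  have "continuous_on (ball 0 1)
      (\<lambda>w. \<Sum>m. taylor_coeff F m * cnj (taylor_coeff F m) * (w * cnj w) ^ m)"
    by (intro continuous_on_compose2[OF continuous_on_hadamard_product[OF F F]] continuous_intros)
      (use sq in auto)
  then have H: "continuous_on (ball 0 1) (\<lambda>w. hardy_inner (\<lambda>z. F (z * cnj w)) (\<lambda>z. F (z * cnj w)))"
    by (rule continuous_on_eq)
      (simp add: hardy_inner_def taylor_coeff_dilate[OF F] power_mult_distrib mult_ac)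
  have "continuous_on (ball 0 1)
      (\<lambda>w. LINT z:ball 0 1|lborel. deriv F (z * cnj w) * cnj w * cnj (deriv F (z * cnj w) * cnj w))"
  proof (rule continuous_on_ball_if_smaller)
    fix r :: real assume r: "0 < r" "r < 1"
    obtain M where M: "\<And>w z. w \<in> cball 0 r \<Longrightarrow> z \<in> ball 0 1 \<Longrightarrow>
        cmod (deriv F (z * cnj w) * cnj w) \<le> M"
      using bounded_deriv_dilate[OF F r(2)] by blast
    show "continuous_on (cball 0 r)
      (\<lambda>w. LINT z:ball 0 1|lborel. deriv F (z * cnj w) * cnj w * cnj (deriv F (z * cnj w) * cnj w))"
    proof (rule continuous_on_set_lebesgue_integral)
      show "set_integrable lborel (ball 0 1) (\<lambda>_::complex. M * M)"
        by (rule set_integrable_ball_const)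
      fix w z :: complex assume w: "w \<in> cball 0 r" and z: "z \<in> ball 0 1"
      show "cmod (deriv F (z * cnj w) * cnj w * cnj (deriv F (z * cnj w) * cnj w)) \<le> M * M"
        unfolding norm_mult[of _ "cnj (deriv F (z * cnj w) * cnj w)"] complex_mod_cnj
        using M[OF w z] order_trans[OF norm_ge_zero M[OF w z]] by (intro mult_mono) auto
    next
      fix w :: complex assume "w \<in> cball 0 r"
      then show "continuous_on (ball 0 1)
          (\<lambda>z. deriv F (z * cnj w) * cnj w * cnj (deriv F (z * cnj w) * cnj w))"
        using continuous_on_deriv_dilate(1)[OF F, of w] r
        by (intro continuous_on_mult[where f = "\<lambda>z. deriv F (z * cnj w) * cnj w"] continuous_on_cnj) auto
    next
      fix z :: complex assume "z \<in> ball 0 1"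
      then show "continuous_on (cball 0 r)
          (\<lambda>w. deriv F (z * cnj w) * cnj w * cnj (deriv F (z * cnj w) * cnj w))"
        using continuous_on_deriv_dilate(2)[OF F, of z r] r
        by (intro continuous_on_mult[where f = "\<lambda>w. deriv F (z * cnj w) * cnj w"] continuous_on_cnj) auto
    qed simp
  qed
  then have "continuous_on (ball 0 1)
      (\<lambda>w. LINT z:ball 0 1|lborel. deriv (\<lambda>z. F (z * cnj w)) z * cnj (deriv (\<lambda>z. F (z * cnj w)) z))"
    by (rule continuous_on_eq)
      (intro set_lebesgue_integral_cong, auto simp: deriv_dilate[OF F])
  then show ?thesis
    unfolding dirichlet_norm_def dirichlet_inner_def using H by (intro continuous_intros)
qed

section \<open>Positivity of the norm and the kernel as a dilate\<close>

lemma dirichlet_norm_pos: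
  assumes "summable (\<lambda>m. taylor_coeff f m * cnj (taylor_coeff f m))" "f 0 \<noteq> 0"
  shows "dirichlet_norm f > 0"
proof -
  have sq: "u * cnj u = of_real ((cmod u)\<^sup>2)" for u
    by (rule complex_norm_square[symmetric])
  have S: "summable (\<lambda>m. (cmod (taylor_coeff f m))\<^sup>2)"
    using assms(1) unfolding sq by (simp only: summable_complex_of_real)
  \<comment> \<open>The zeroth coefficient is \<open>f 0\<close>, so one term of the nonnegative
    Hardy series is already positive.\<close>
  have "0 < (cmod (taylor_coeff f 0))\<^sup>2"
    using assms(2) by (simp add: taylor_coeff_def)
  then have "0 < (\<Sum>m. (cmod (taylor_coeff f m))\<^sup>2)"
    by (intro suminf_pos2[OF S]) auto
  moreover have "0 \<le> (LINT z:ball 0 1|lborel. (cmod (deriv f z))\<^sup>2)"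
    unfolding set_lebesgue_integral_def by (intro Bochner_Integration.integral_nonneg) simp
  moreover have "dirichlet_inner f f = of_real ((\<Sum>m. (cmod (taylor_coeff f m))\<^sup>2) +
      1 / pi * (LINT z:ball 0 1|lborel. (cmod (deriv f z))\<^sup>2))"
    unfolding dirichlet_inner_def hardy_inner_def sq set_integral_complex_of_real
    by (simp add: suminf_of_real[OF S])
  ultimately show ?thesis
    by (auto simp: dirichlet_norm_def intro!: add_pos_nonneg)
qed

text \<open>On the disk this is the sum of u^m / (m + 1); the value 1 at 0 fills the removable
  singularity.\<close>

definition dirichlet_log :: "complex \<Rightarrow> complex" where
  "dirichlet_log u = (if u = 0 then 1 else - Ln (1 - u) / u)"

text \<open>The function is the difference quotient at 0 of -Ln (1 - u), completed at 0 by the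
  derivative there; such a quotient of a holomorphic function is holomorphic.\<close>

lemma holomorphic_dirichlet_log: "dirichlet_log holomorphic_on ball 0 1"
proof -
  have 1: "1 - u \<notin> \<real>\<^sub>\<le>\<^sub>0" if "cmod u < 1" for u
    using that abs_Re_le_cmod[of u] by (auto simp: complex_nonpos_Reals_iff)
  have "((\<lambda>u. - Ln (1 - u)) has_field_derivative 1) (at 0)"
    by (auto intro!: derivative_eq_intros)
  then have "deriv (\<lambda>u. - Ln (1 - u)) 0 = 1"
    by (rule DERIV_imp_deriv)
  then have eq: "dirichlet_log = (\<lambda>u. if u = 0 then deriv (\<lambda>u. - Ln (1 - u)) 0
      else (- Ln (1 - u) - (- Ln (1 - 0))) / (u - 0))"
    by (auto simp: dirichlet_log_def fun_eq_iff)
  show ?thesis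
    unfolding eq by (rule pole_lemma_open) (use 1 in \<open>auto intro!: holomorphic_intros\<close>)
qed

text \<open>The point 1 - z * cnj w has positive real part, hence avoids the cut, and
  \<open>Ln\<close> turns its inverse into a minus sign.\<close>

lemma dirichlet_kernel_eq:
  assumes "w \<in> ball 0 1" "z \<in> ball 0 1"
  shows "dirichlet_kernel w z = dirichlet_log (z * cnj w)"
proof (cases "w = 0 \<or> z = 0")
  case False
  have "cmod (z * cnj w) < 1"
    using dilate_in_ball(2)[of z w 1] assms by auto
  then have "1 - z * cnj w \<notin> \<real>\<^sub>\<le>\<^sub>0"
    using abs_Re_le_cmod[of "z * cnj w"] by (auto simp: complex_nonpos_Reals_iff simp del: times_complex.sel)
  then show ?thesis
    using False Ln_inverse[of "1 - z * cnj w"]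
    by (simp add: dirichlet_kernel_def dirichlet_log_def divide_inverse)
qed (auto simp: dirichlet_kernel_def dirichlet_log_def)

theorem theorem5p1:
  fixes n :: nat
    and a :: "nat \<Rightarrow> nat \<Rightarrow> complex"
    and g :: "nat \<Rightarrow> complex \<Rightarrow> complex"
    and T :: "(complex \<Rightarrow> complex) \<Rightarrow> (complex \<Rightarrow> complex)"
  assumes "\<And>j. j \<in> {1..n} \<Longrightarrow> g j \<in> dirichlet_space"
    and "\<And>j z. j \<in> {1..n} \<Longrightarrow> z \<in> ball 0 1 \<Longrightarrow>
           (\<lambda>m. a j (Suc m) * z ^ Suc m) sums g j z"
    and "\<And>f z. f \<in> dirichlet_space \<Longrightarrow> z \<in> ball 0 1 \<Longrightarrow>
           T f z = (\<Sum>j = 1..n. dirichlet_inner f (g j) * g j z)"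
  shows "convex (berezin_range T)"
proof -
  note g = assms(1) and T = assms(3)
  define k where "k w = (\<lambda>z. dirichlet_log (z * cnj w))" for w
  define c where "c w = dirichlet_norm (k w)" for w
  define \<beta> where "\<beta> w = (\<Sum>j = 1..n. (cmod (dirichlet_inner (k w) (g j)))\<^sup>2) / (c w)\<^sup>2" for w
  have k_space: "k w \<in> dirichlet_space" if "w \<in> ball 0 1" for w
    unfolding k_def using holomorphic_dirichlet_log that by (rule dilate_in_dirichlet_space)
  have summ: "summable (\<lambda>m. taylor_coeff (k w) m * cnj (taylor_coeff f m))"
    if "w \<in> ball 0 1" "f \<in> dirichlet_space" for w f
    unfolding k_def using holomorphic_dirichlet_log that(2,1) by (rule summable_dirichlet_inner_dilate)
  have c_pos: "c w > 0" if "w \<in> ball 0 1" for w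
    unfolding c_def using summ[OF that k_space[OF that]]
    by (rule dirichlet_norm_pos) (simp add: k_def dirichlet_log_def)
  have "dirichlet_inner (T (normalized_kernel w)) (normalized_kernel w) = of_real (\<beta> w)"
    if w: "w \<in> ball 0 1" for w
  proof -
    \<comment> \<open>Putting the normalizing constant into \<open>F\<close> makes the normalized
      kernel a dilate \<open>q\<close> too, so the lemmas on dilates apply to it directly.\<close>
    define F where "F u = dirichlet_log u / of_real (c w)" for u
    define q where "q z = F (z * cnj w)" for z
    have F: "F holomorphic_on ball 0 1"
      unfolding F_def divide_inverse by (intro holomorphic_intros holomorphic_dirichlet_log)
    have q_space: "q \<in> dirichlet_space"
      unfolding q_def using F w by (rule dilate_in_dirichlet_space)
    have q_summ: "summable (\<lambda>m. taylor_coeff q m * cnj (taylor_coeff (g j) m))" if "j \<in> {1..n}" for j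
      unfolding q_def using F g[OF that] w by (rule summable_dirichlet_inner_dilate)
    have "dirichlet_norm (dirichlet_kernel w) = c w"
      unfolding dirichlet_norm_def c_def
      using dirichlet_inner_cong[of "dirichlet_kernel w" "k w" "dirichlet_kernel w" "k w"]
        dirichlet_kernel_eq[OF w] by (simp add: k_def)
    then have nk: "normalized_kernel w z = q z" if "z \<in> ball 0 1" for z
      using dirichlet_kernel_eq[OF w that] by (simp add: normalized_kernel_def q_def F_def)
    have nk_space: "normalized_kernel w \<in> dirichlet_space"
      using dirichlet_space_cong[of "normalized_kernel w" q] nk q_space by blast
    have inner_q: "dirichlet_inner q (g j) = dirichlet_inner (k w) (g j) / of_real (c w)"
      if j: "j \<in> {1..n}" for j
    proof -
      \<comment> \<open>Homogeneity in the first slot is linearity for a sum over a one-element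
        index set.\<close>
      have "q = (\<lambda>z. \<Sum>i\<in>{()}. 1 / of_real (c w) * k w z)"
        by (simp add: q_def F_def k_def fun_eq_iff)
      then show ?thesis
        using dirichlet_inner_sum_left[of "{()}" "\<lambda>_. k w" "g j" "\<lambda>_. 1 / of_real (c w)"]
          k_space[OF w] summ[OF w g[OF j]] dirichlet_space_integrable[OF k_space[OF w] g[OF j]]
        by (simp add: dirichlet_space_def)
    qed
    have "dirichlet_inner (T (normalized_kernel w)) (normalized_kernel w) =
        dirichlet_inner (\<lambda>z. \<Sum>j = 1..n. dirichlet_inner q (g j) * g j z) q"
      \<comment> \<open>The formula for \<open>T\<close> is given only on the Dirichlet space and at
        points of the disk, hence the need for \<open>nk_space\<close> and for congruence on the
        disk.\<close>
      using T[OF nk_space] nk dirichlet_inner_cong[of "normalized_kernel w" q]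
      by (intro dirichlet_inner_cong) auto
    also have "\<dots> = (\<Sum>j = 1..n. dirichlet_inner q (g j) * dirichlet_inner (g j) q)"
    proof (rule dirichlet_inner_sum_left)
      fix j assume j: "j \<in> {1..n}"
      show "g j holomorphic_on ball 0 1"
        using g[OF j] by (simp add: dirichlet_space_def)
      show "summable (\<lambda>m. taylor_coeff (g j) m * cnj (taylor_coeff q m))"
        using bounded_linear.summable[OF bounded_linear_cnj q_summ[OF j]] by (simp add: mult.commute)
      show "set_integrable lborel (ball 0 1) (\<lambda>z. deriv (g j) z * cnj (deriv q z))"
        using g[OF j] q_space by (rule dirichlet_space_integrable)
    qed simp
    also have "\<dots> = (\<Sum>j = 1..n. of_real ((cmod (dirichlet_inner (k w) (g j)))\<^sup>2 / (c w)\<^sup>2))"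
    proof (rule sum.cong)
      fix j assume j: "j \<in> {1..n}"
      \<comment> \<open>The two factors are complex conjugates, which is what makes the Berezin
        transform real.\<close>
      have "dirichlet_inner q (g j) * dirichlet_inner (g j) q = of_real ((cmod (dirichlet_inner q (g j)))\<^sup>2)"
        by (simp only: dirichlet_inner_commute[OF q_summ[OF j]] complex_norm_square)
      then show "dirichlet_inner q (g j) * dirichlet_inner (g j) q =
          of_real ((cmod (dirichlet_inner (k w) (g j)))\<^sup>2 / (c w)\<^sup>2)"
        by (simp add: inner_q[OF j] norm_divide power_divide)
    qed simp
    finally show ?thesis
      by (simp add: \<beta>_def sum_divide_distrib)
  qed
  then have ber: "berezin_range T = complex_of_real ` \<beta> ` ball 0 1"
    unfolding berezin_range_def Setcompr_eq_image image_image by (intro image_cong) auto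
  have "continuous_on (ball 0 1) \<beta>"
    unfolding \<beta>_def
  proof (intro continuous_intros)
    show "continuous_on (ball 0 1) c"
      unfolding c_def k_def by (intro continuous_on_dirichlet_norm_dilate holomorphic_dirichlet_log)
    show "continuous_on (ball 0 1) (\<lambda>w. dirichlet_inner (k w) (g j))" if "j \<in> {1..n}" for j
      unfolding k_def
      by (intro continuous_on_dirichlet_inner_dilate holomorphic_dirichlet_log g[OF that])
    show "\<forall>w\<in>ball 0 1. (c w)\<^sup>2 \<noteq> 0"
      using c_pos by force
  qed
  then have "connected (\<beta> ` ball 0 1)"
    by (intro connected_continuous_image) auto
  \<comment> \<open>In the real line, connected sets, intervals and convex sets coincide; the
    real-linear embedding into the complex plane then preserves convexity.\<close>
  then have "convex (\<beta> ` ball 0 1)"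
    by (simp add: is_interval_connected_1[symmetric] is_interval_convex_1[symmetric])
  then show ?thesis
    unfolding ber by (rule convex_linear_image[OF linear_of_real])
qed

end
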